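(* Let $(\mathbf p,\mathbf t)$ be the optimal solution to the problem (P3) defined in the context. Then there are an index set $\mathcal S_{\mathsf a}\in\{\{1\},\{1,2\},\dots,\{1,2,\dots,S\}\}$ (indices of the activated cascaded paths) and an index set $\mathcal I_{\mathsf a}\in\{\{1\},\{1,2\},\dots,\{1,2,\dots,L_3\}\}$ (indices of the activated direct paths), with $p_s^{\mathsf r}=t_s=0$ for $s\notin\mathcal S_{\mathsf a}$ and $p_i^{\mathsf d}=0$ for $i\notin\mathcal I_{\mathsf a}$, such that the following holds. If $\mathcal S_{\mathsf a}=\{1\}$, then $\mathbf t=(1,0,\dots,0)$ and $\mathbf p$ is the water-filling power allocation for this $\mathbf t$: for some $v>0$, $p_1^{\mathsf r}=\max\{0,\frac1v-\frac1{m_1^{\mathsf r}}\}$, $p_s^{\mathsf r}=0$ for $s\ge2$, and $p_i^{\mathsf d}=\max\{0,\frac1v-\frac1{m_i^{\mathsf d}}\}$ for all $i$, with total power $P$. Otherwise, $(\mathbf p,\mathbf t)$ necessarily satisfies, with $v$ and $w$ the dual variables of the constraints $\sum_s p_s^{\mathsf r}+\sum_i p_i^{\mathsf d}=P$ and $\sum_s t_s=1$ respectively, and with $P^{\mathsf r}=\sum_{s}p_s^{\mathsf r}$, the system of nonlinear equations $$p_s^{\mathsf r}=\frac1v-\frac1{m_s^{\mathsf r}t_s^2}\ \ (s\in\mathcal S_{\mathsf a}),\qquad p_i^{\mathsf d}=\frac1v-\frac1{m_i^{\mathsf d}}\ \ (i\in\mathcal I_{\mathsf a}),$$ $$t_s=\frac1w+\sqrt{\frac1{w^2}-\frac1{m_s^{\mathsf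 r}p_s^{\mathsf r}}}\ \ (s\in\mathcal S_{\mathsf a}),\qquad t_s=\frac{2v}{w}\,p_s^{\mathsf r}=\frac1{P^{\mathsf r}}\,p_s^{\mathsf r}\ \ (s\in\mathcal S_{\mathsf a}),$$ $$\sum_{s\in\mathcal S_{\mathsf a}}p_s^{\mathsf r}+\sum_{i\in\mathcal I_{\mathsf a}}p_i^{\mathsf d}=P,\qquad \sum_{s\in\mathcal S_{\mathsf a}}t_s=1.$$ Consequently, the optimal $(\mathbf p,\mathbf t)$ is found by computing all the feasible solutions of this kind, over all choices of $\mathcal S_{\mathsf a}$ and $\mathcal I_{\mathsf a}$, and taking the one with the largest objective value.
   Context: Let $S,L_3\ge1$ be integers, $P>0$, and let $m_1^{\mathsf r}\ge\cdots\ge m_S^{\mathsf r}>0$ and $m_1^{\mathsf d}\ge\cdots\ge m_{L_3}^{\mathsf d}>0$ be real numbers (gains of $S$ cascaded paths and $L_3$ direct paths of a wireless channel). Here $\log$ is the natural logarithm. Problem (P3): maximize over $\mathbf p=(p_1^{\mathsf r},\dots,p_S^{\mathsf r},p_1^{\mathsf d},\dots,p_{L_3}^{\mathsf d})$ and $\mathbf t=(t_1,\dots,t_S)$ the function $$C(\mathbf p,\mathbf t)=\sum_{s=1}^S\log\left(1+m_s^{\mathsf r}p_s^{\mathsf r}t_s^2\right)+\sum_{i=1}^{L_3}\log\left(1+m_i^{\mathsf d}p_i^{\mathsf d}\right)$$ subject to $p_s^{\mathsf r}\ge0$ and $t_s\ge0$ for all $s$, $p_i^{\mathsf d}\ge0$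 for all $i$, $\sum_{s}p_s^{\mathsf r}+\sum_i p_i^{\mathsf d}=P$, and $\sum_s t_s=1$. The dual variables $v,w$ are those of the two equality constraints in the KKT conditions of (P3), i.e. the multipliers in the Lagrangian $-C(\mathbf p,\mathbf t)-\sum_s\lambda_s^{\mathsf r}p_s^{\mathsf r}-\sum_i\lambda_i^{\mathsf d}p_i^{\mathsf d}+v(\sum_sp_s^{\mathsf r}+\sum_ip_i^{\mathsf d}-P)-\sum_s\mu_st_s+w(\sum_st_s-1)$.
   Formalization: Optima need not be unique: the claim is for optima activating lower indices first among equal cascaded gains, with t=(1,0,…,0) if P^r=0; every optimum can be brought to this form. The set I_a may be empty when S_a≠{1}, since direct paths can all be inactive with 1/v<1/m_1^d. *)

theory Defs
  imports "HOL-Analysis.Analysis"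
begin

text \<open>
  A point of (P3) is a triple \<open>pr, pd, t\<close> of functions on the naturals; only the values
  \<open>pr s\<close>, \<open>t s\<close> for \<open>s \<in> {1..S}\<close> and \<open>pd i\<close> for \<open>i \<in> {1..L}\<close> matter. The gains of the
  cascaded and direct paths are \<open>mr\<close> and \<open>md\<close>.
\<close>

definition P3_objective ::
  "nat \<Rightarrow> nat \<Rightarrow> (nat \<Rightarrow> real) \<Rightarrow> (nat \<Rightarrow> real) \<Rightarrow>
   (nat \<Rightarrow> real) \<Rightarrow> (nat \<Rightarrow> real) \<Rightarrow> (nat \<Rightarrow> real) \<Rightarrow> real" where
  "P3_objective S L mr md pr pd t =
     (\<Sum>s = 1..S. ln (1 + mr s * pr s * (t s)\<^sup>2)) + (\<Sum>i = 1..L. ln (1 + md i * pd i))"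

definition P3_feasible ::
  "nat \<Rightarrow> nat \<Rightarrow> real \<Rightarrow> (nat \<Rightarrow> real) \<Rightarrow> (nat \<Rightarrow> real) \<Rightarrow> (nat \<Rightarrow> real) \<Rightarrow> bool" where
  "P3_feasible S L P pr pd t \<longleftrightarrow>
     (\<forall>s\<in>{1..S}. 0 \<le> pr s) \<and> (\<forall>s\<in>{1..S}. 0 \<le> t s) \<and> (\<forall>i\<in>{1..L}. 0 \<le> pd i) \<and>
     (\<Sum>s = 1..S. pr s) + (\<Sum>i = 1..L. pd i) = P \<and> (\<Sum>s = 1..S. t s) = 1"

definition P3_optimal ::
  "nat \<Rightarrow> nat \<Rightarrow> real \<Rightarrow> (nat \<Rightarrow> real) \<Rightarrow> (nat \<Rightarrow> real) \<Rightarrow>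
   (nat \<Rightarrow> real) \<Rightarrow> (nat \<Rightarrow> real) \<Rightarrow> (nat \<Rightarrow> real) \<Rightarrow> bool" where
  "P3_optimal S L P mr md pr pd t \<longleftrightarrow>
     P3_feasible S L P pr pd t \<and>
     (\<forall>pr' pd' t'. P3_feasible S L P pr' pd' t' \<longrightarrow>
        P3_objective S L mr md pr' pd' t' \<le> P3_objective S L mr md pr pd t)"

definition P3_lagrangian ::
  "nat \<Rightarrow> nat \<Rightarrow> real \<Rightarrow> (nat \<Rightarrow> real) \<Rightarrow> (nat \<Rightarrow> real) \<Rightarrow>
   (nat \<Rightarrow> real) \<Rightarrow> (nat \<Rightarrow> real) \<Rightarrow> real \<Rightarrow> (nat \<Rightarrow> real) \<Rightarrow> real \<Rightarrow>
   (nat \<Rightarrow> real) \<Rightarrow> (nat \<Rightarrow> real) \<Rightarrow> (nat \<Rightarrow> real) \<Rightarrow> real" where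
  "P3_lagrangian S L P mr md lr ld v \<mu> w pr pd t =
     - P3_objective S L mr md pr pd t
     - (\<Sum>s = 1..S. lr s * pr s) - (\<Sum>i = 1..L. ld i * pd i)
     + v * ((\<Sum>s = 1..S. pr s) + (\<Sum>i = 1..L. pd i) - P)
     - (\<Sum>s = 1..S. \<mu> s * t s) + w * ((\<Sum>s = 1..S. t s) - 1)"

text \<open>The KKT conditions; stationarity is the vanishing of all partial derivatives.\<close>

definition P3_KKT ::
  "nat \<Rightarrow> nat \<Rightarrow> real \<Rightarrow> (nat \<Rightarrow> real) \<Rightarrow> (nat \<Rightarrow> real) \<Rightarrow>
   (nat \<Rightarrow> real) \<Rightarrow> (nat \<Rightarrow> real) \<Rightarrow> real \<Rightarrow> (nat \<Rightarrow> real) \<Rightarrow> real \<Rightarrow>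
   (nat \<Rightarrow> real) \<Rightarrow> (nat \<Rightarrow> real) \<Rightarrow> (nat \<Rightarrow> real) \<Rightarrow> bool" where
  "P3_KKT S L P mr md lr ld v \<mu> w pr pd t \<longleftrightarrow>
     P3_feasible S L P pr pd t \<and>
     (\<forall>s\<in>{1..S}. 0 \<le> lr s) \<and> (\<forall>i\<in>{1..L}. 0 \<le> ld i) \<and> (\<forall>s\<in>{1..S}. 0 \<le> \<mu> s) \<and>
     (\<forall>s\<in>{1..S}. lr s * pr s = 0) \<and> (\<forall>i\<in>{1..L}. ld i * pd i = 0) \<and>
     (\<forall>s\<in>{1..S}. \<mu> s * t s = 0) \<and>
     (\<forall>s\<in>{1..S}. ((\<lambda>x. P3_lagrangian S L P mr md lr ld v \<mu> w (pr(s := x)) pd t)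
                    has_real_derivative 0) (at (pr s))) \<and>
     (\<forall>i\<in>{1..L}. ((\<lambda>x. P3_lagrangian S L P mr md lr ld v \<mu> w pr (pd(i := x)) t)
                    has_real_derivative 0) (at (pd i))) \<and>
     (\<forall>s\<in>{1..S}. ((\<lambda>x. P3_lagrangian S L P mr md lr ld v \<mu> w pr pd (t(s := x)))
                    has_real_derivative 0) (at (t s)))"

definition P3_dual_variables ::
  "nat \<Rightarrow> nat \<Rightarrow> real \<Rightarrow> (nat \<Rightarrow> real) \<Rightarrow> (nat \<Rightarrow> real) \<Rightarrow>
   (nat \<Rightarrow> real) \<Rightarrow> (nat \<Rightarrow> real) \<Rightarrow> (nat \<Rightarrow> real) \<Rightarrow> real \<Rightarrow> real \<Rightarrow> bool" where
  "P3_dual_variables S L P mr md pr pd t v w \<longleftrightarrow>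
     (\<exists>lr ld \<mu>. P3_KKT S L P mr md lr ld v \<mu> w pr pd t)"

text \<open>
  The admissible pairs of index sets of activated cascaded and direct paths. Both are nonempty
  initial segments, with one exception: when several cascaded paths are activated, it can happen
  that no direct path carries power and \<open>pd 1 = 1/v - 1/md 1\<close> would be negative. Only
  \<open>{}\<close> describes this case.
\<close>

definition activation_sets :: "nat \<Rightarrow> nat \<Rightarrow> (nat set \<times> nat set) set" where
  "activation_sets S L =
     {(Sa, Ia). (\<exists>k\<in>{1..S}. Sa = {1..k}) \<and>
                ((\<exists>l\<in>{1..L}. Ia = {1..l}) \<or> (Sa \<noteq> {1} \<and> Ia = {}))}"

definition inactive_zero ::
  "nat \<Rightarrow> nat \<Rightarrow> nat set \<Rightarrow> nat set \<Rightarrow>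
   (nat \<Rightarrow> real) \<Rightarrow> (nat \<Rightarrow> real) \<Rightarrow> (nat \<Rightarrow> real) \<Rightarrow> bool" where
  "inactive_zero S L Sa Ia pr pd t \<longleftrightarrow>
     (\<forall>s\<in>{1..S} - Sa. pr s = 0 \<and> t s = 0) \<and> (\<forall>i\<in>{1..L} - Ia. pd i = 0)"

definition single_path_water_filling ::
  "nat \<Rightarrow> nat \<Rightarrow> real \<Rightarrow> (nat \<Rightarrow> real) \<Rightarrow> (nat \<Rightarrow> real) \<Rightarrow>
   (nat \<Rightarrow> real) \<Rightarrow> (nat \<Rightarrow> real) \<Rightarrow> (nat \<Rightarrow> real) \<Rightarrow> bool" where
  "single_path_water_filling S L P mr md pr pd t \<longleftrightarrow>
     t 1 = 1 \<and> (\<forall>s\<in>{2..S}. t s = 0) \<and>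
     (\<exists>v>0. pr 1 = max 0 (1 / v - 1 / mr 1) \<and> (\<forall>s\<in>{2..S}. pr s = 0) \<and>
            (\<forall>i\<in>{1..L}. pd i = max 0 (1 / v - 1 / md i))) \<and>
     (\<Sum>s = 1..S. pr s) + (\<Sum>i = 1..L. pd i) = P"

text \<open>
  The sign conditions make every quotient and the square root below meaningful (division by zero
  and roots of negative numbers are total functions here).
\<close>

definition multi_path_system ::
  "nat \<Rightarrow> real \<Rightarrow> (nat \<Rightarrow> real) \<Rightarrow> (nat \<Rightarrow> real) \<Rightarrow> nat set \<Rightarrow> nat set \<Rightarrow>
   real \<Rightarrow> real \<Rightarrow> (nat \<Rightarrow> real) \<Rightarrow> (nat \<Rightarrow> real) \<Rightarrow> (nat \<Rightarrow> real) \<Rightarrow> bool" where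
  "multi_path_system S P mr md Sa Ia v w pr pd t \<longleftrightarrow>
     0 < v \<and> 0 < w \<and>
     (\<forall>s\<in>Sa. 0 < pr s \<and> 0 < t s \<and> 0 \<le> 1 / w\<^sup>2 - 1 / (mr s * pr s)) \<and>
     (\<forall>s\<in>Sa. pr s = 1 / v - 1 / (mr s * (t s)\<^sup>2)) \<and>
     (\<forall>i\<in>Ia. pd i = 1 / v - 1 / md i) \<and>
     (\<forall>s\<in>Sa. t s = 1 / w + sqrt (1 / w\<^sup>2 - 1 / (mr s * pr s))) \<and>
     (\<forall>s\<in>Sa. t s = 2 * v / w * pr s \<and> t s = 1 / (\<Sum>r = 1..S. pr r) * pr s) \<and>
     (\<Sum>s\<in>Sa. pr s) + (\<Sum>i\<in>Ia. pd i) = P \<and>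
     (\<Sum>s\<in>Sa. t s) = 1"

text \<open>
  A feasible solution of the kind enumerated by the method. Here \<open>v\<close> and \<open>w\<close> are unknowns of the
  nonlinear system.
\<close>

definition P3_candidate ::
  "nat \<Rightarrow> nat \<Rightarrow> real \<Rightarrow> (nat \<Rightarrow> real) \<Rightarrow> (nat \<Rightarrow> real) \<Rightarrow>
   (nat \<Rightarrow> real) \<Rightarrow> (nat \<Rightarrow> real) \<Rightarrow> (nat \<Rightarrow> real) \<Rightarrow> bool" where
  "P3_candidate S L P mr md pr pd t \<longleftrightarrow>
     P3_feasible S L P pr pd t \<and>
     (\<exists>(Sa, Ia)\<in>activation_sets S L. inactive_zero S L Sa Ia pr pd t \<and>
        (if Sa = {1} then single_path_water_filling S L P mr md pr pd t
         else (\<exists>v w. multi_path_system S P mr md Sa Ia v w pr pd t)))"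

definition P3_best_candidate ::
  "nat \<Rightarrow> nat \<Rightarrow> real \<Rightarrow> (nat \<Rightarrow> real) \<Rightarrow> (nat \<Rightarrow> real) \<Rightarrow>
   (nat \<Rightarrow> real) \<Rightarrow> (nat \<Rightarrow> real) \<Rightarrow> (nat \<Rightarrow> real) \<Rightarrow> bool" where
  "P3_best_candidate S L P mr md pr pd t \<longleftrightarrow>
     P3_candidate S L P mr md pr pd t \<and>
     (\<forall>pr' pd' t'. P3_candidate S L P mr md pr' pd' t' \<longrightarrow>
        P3_objective S L mr md pr' pd' t' \<le> P3_objective S L mr md pr pd t)"

text \<open>
  Optimal solutions need not be unique: paths of equal gain are interchangeable, and \<open>t\<close> does not
  affect the objective when no cascaded path carries power. The following convention selects a
  representative: among cascaded paths of equal gain those of smaller index are activated first,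
  and if no cascaded path carries power then \<open>t = (1, 0, \<dots>, 0)\<close>. It is vacuous if the cascaded
  gains are distinct and some cascaded path carries power, and it holds automatically for a unique
  optimal solution.
\<close>

definition normalized ::
  "nat \<Rightarrow> (nat \<Rightarrow> real) \<Rightarrow> (nat \<Rightarrow> real) \<Rightarrow> (nat \<Rightarrow> real) \<Rightarrow> bool" where
  "normalized S mr pr t \<longleftrightarrow>
     (\<forall>r\<in>{1..S}. \<forall>s\<in>{1..S}. r < s \<and> mr r = mr s \<and> pr s \<noteq> 0 \<longrightarrow> pr r \<noteq> 0) \<and>
     ((\<forall>s\<in>{1..S}. pr s = 0) \<longrightarrow> (\<forall>s\<in>{2..S}. t s = 0))"

end

theory Submission
  imports Defs "HOL-Combinatorics.Permutations"
begin

text \<open>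
  Exchanging mass between two coordinates of a simplex yields the dual variables at an optimum. With
  them, an active cascaded path satisfies \<open>t s = (2 * v / w) * pr s\<close>, and \<open>t s\<close> is one of the two
  roots of a quadratic equation. If two paths are active, merging one into the other shows that each
  of them has signal-to-noise ratio above 2, which excludes the smaller root. Swapping paths shows
  that the active sets are initial segments.
\<close>

text \<open>With several cascaded paths the objective is not jointly concave: along
  \<open>t s = c * pr s\<close> a summand has the form \<open>ln (1 + k * x ^ 3)\<close>, which is
  convex for small positive \<open>x\<close>. The KKT conditions are therefore only necessary, and
  the condition in \<open>t s\<close> does not tell the two roots apart; it takes a distant
  competitor, one path absorbing another, to do so. Nor can multipliers certify a candidate: the
  last claim rests on the existence of an optimum, by compactness, and on some optimum being a
  candidate. An optimum of (P3) is optimal in the powers for fixed \<open>t\<close>, and in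
  \<open>t\<close> for fixed powers. These are separable problems over a simplex each, and their
  first-order conditions together are the KKT conditions. If no cascaded path carries power, every
  derivative in \<open>t\<close> vanishes, so \<open>w = 0\<close> and \<open>t\<close> is
  undetermined. This degeneracy and ties between equal gains are what \<open>normalized\<close>
  resolves.\<close>

section \<open>Sums, initial segments and the scalar equations\<close>

lemma sum_change_two:
  fixes f g :: "'a \<Rightarrow> real"
  assumes "finite A" "r \<in> A" "s \<in> A" "r \<noteq> s" "\<And>k. k \<in> A - {r, s} \<Longrightarrow> g k = f k"
  shows "sum g A = sum f A - f r - f s + g r + g s"
proof -
  have split: "sum h A = h r + (h s + sum h (A - {r, s}))" for h :: "'a \<Rightarrow> real"
    using assms by (subst sum.remove[of _ r], simp, simp, subst sum.remove[of _ s])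
      (auto simp: Diff_insert2[symmetric] intro!: arg_cong[of _ _ "sum h"])
  have "sum g (A - {r, s}) = sum f (A - {r, s})" using assms(5) by (intro sum.cong) auto
  then show ?thesis using split[of f] split[of g] by simp
qed

lemma downward_closed_eq_atLeastAtMost:
  fixes A :: "nat set"
  assumes "A \<subseteq> {1..n}" "A \<noteq> {}" "\<And>i j. i \<in> {1..n} \<Longrightarrow> j \<in> A \<Longrightarrow> i < j \<Longrightarrow> i \<in> A"
  shows "\<exists>k\<in>{1..n}. A = {1..k}"
proof -
  have fin: "finite A" using assms(1) finite_subset by blast
  have Max: "Max A \<in> A" using fin assms(2) by simp
  have "i \<in> A \<longleftrightarrow> i \<in> {1..Max A}" for i
  proof
    show "i \<in> {1..Max A}" if "i \<in> A" using fin that assms(1) by auto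
    show "i \<in> A" if i: "i \<in> {1..Max A}"
    proof (cases "i = Max A")
      case False
      then show ?thesis using i Max assms(1) by (intro assms(3)[OF _ Max]) auto
    qed (use Max in simp)
  qed
  then show ?thesis using Max assms(1) by blast
qed

text \<open>The marginal rate \<open>c / (1 + c * p)\<close> is the reciprocal of
  \<open>1 / c + p\<close>, so equality with \<open>v\<close> reads
  \<open>1 / v = 1 / c + p\<close>. At \<open>p = 0\<close> the inequality says
  \<open>c \<le> v\<close>, which makes the maximum 0. The gain \<open>c\<close> will be
  \<open>md i\<close>, or \<open>mr s\<close> times the squared time share.\<close>

lemma water_level_solution:
  fixes c p v :: real
  assumes "0 < c" "0 \<le> p" "c / (1 + c * p) \<le> v" "0 < p \<Longrightarrow> c / (1 + c * p) = v"
  shows "p = max 0 (1 / v - 1 / c)" "0 < v" "0 < p \<Longrightarrow> p = 1 / v - 1 / c"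
proof -
  have pos: "0 < 1 + c * p" using assms(1,2) by (simp add: add_pos_nonneg)
  then have "0 < c / (1 + c * p)" using assms(1) by simp
  then show v: "0 < v" using assms(3) by simp
  show act: "p = 1 / v - 1 / c" if "0 < p"
  proof -
    have "1 / v = 1 / c + p"
      unfolding assms(4)[OF that, symmetric] using assms(1) by (simp add: add_divide_distrib)
    then show ?thesis by simp
  qed
  show "p = max 0 (1 / v - 1 / c)"
  proof (cases "0 < p")
    case True
    then show ?thesis using act by simp
  next
    case False
    then have "p = 0" using assms(2) by simp
    then show ?thesis using assms(1,3) v by (simp add: max_def field_simps)
  qed
qed

text \<open>
  With \<open>x = a * p * t\<^sup>2\<close>, solving \<open>w = 2 * a * p * t / (1 + x)\<close> for \<open>t\<close> gives a quadratic equation whose discriminant is the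
  square of \<open>(x - 1) / (2 * a * p * t)\<close>; the larger root is selected by \<open>x \<ge> 1\<close>.
\<close>

lemma time_share_root:
  fixes a p t w :: real
  assumes "0 < a" "0 < p" "0 < t" "1 \<le> a * p * t\<^sup>2"
    and w: "w = 2 * a * p * t / (1 + a * p * t\<^sup>2)"
  shows "0 \<le> 1 / w\<^sup>2 - 1 / (a * p)" "t = 1 / w + sqrt (1 / w\<^sup>2 - 1 / (a * p))"
proof -
  define x where "x = a * p * t\<^sup>2"
  define y where "y = 2 * a * p * t"
  have x: "1 \<le> x" using assms(4) by (simp add: x_def)
  have y: "0 < y" using assms(1-3) by (simp add: y_def)
  have yy: "y\<^sup>2 = 4 * (a * p) * x" by (simp add: x_def y_def power2_eq_square)
  have inv: "1 / w = (1 + x) / y" unfolding w x_def y_def by simp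
  have "1 / (a * p) = 4 * x / y\<^sup>2" using yy y assms(1,2) x by (simp add: field_simps)
  moreover have "1 / w\<^sup>2 = (1 + x)\<^sup>2 / y\<^sup>2" using inv by (metis power_divide power_one)
  ultimately have root: "1 / w\<^sup>2 - 1 / (a * p) = ((x - 1) / y)\<^sup>2"
    by (simp add: power_divide power2_eq_square algebra_simps flip: diff_divide_distrib)
  show "0 \<le> 1 / w\<^sup>2 - 1 / (a * p)" unfolding root by simp
  have "sqrt (1 / w\<^sup>2 - 1 / (a * p)) = (x - 1) / y" unfolding root using x y by simp
  then have "1 / w + sqrt (1 / w\<^sup>2 - 1 / (a * p)) = 2 * x / y"
    unfolding inv by (simp flip: add_divide_distrib)
  also have "\<dots> = t" using assms(1-3) by (simp add: x_def y_def power2_eq_square)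
  finally show "t = 1 / w + sqrt (1 / w\<^sup>2 - 1 / (a * p))" by simp
qed

section \<open>First-order conditions on a simplex\<close>

lemma has_real_derivative_sum_fun_upd:
  fixes F :: "'a \<Rightarrow> real \<Rightarrow> real"
  assumes "finite A" "s \<in> A" "(F s has_real_derivative D) (at (f s))"
  shows "((\<lambda>x. \<Sum>k\<in>A. F k ((f(s := x)) k)) has_real_derivative D) (at (f s))"
proof -
  have "(\<Sum>k\<in>A. F k ((f(s := x)) k)) = F s x + (\<Sum>k\<in>A - {s}. F k (f k))" for x
    using assms by (subst sum.remove[of _ s]) (auto intro!: sum.cong)
  then show ?thesis by (auto intro!: derivative_eq_intros assms(3))
qed

text \<open>Moving a little mass from \<open>j\<close> to \<open>i\<close> changes the value at the
  rate \<open>Di - Dj\<close>, and \<open>0 < y j\<close> leaves room for the move.\<close>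

lemma simplex_exchange:
  fixes y :: "'a \<Rightarrow> real"
  assumes fin: "finite I" and y: "\<And>i. i \<in> I \<Longrightarrow> 0 \<le> y i"
    and opt: "\<And>z. (\<And>i. i \<in> I \<Longrightarrow> 0 \<le> z i) \<Longrightarrow> sum z I = sum y I \<Longrightarrow>
               (\<Sum>i\<in>I. f i (z i)) \<le> (\<Sum>i\<in>I. f i (y i))"
    and ij: "i \<in> I" "j \<in> I" "0 < y j"
    and D: "(f i has_real_derivative Di) (at (y i))" "(f j has_real_derivative Dj) (at (y j))"
  shows "Di \<le> Dj"
proof (cases "i = j")
  case True
  then show ?thesis using D DERIV_unique by blast
next
  case False
  show ?thesis
  proof (rule ccontr)
    assume "\<not> ?thesis"
    then have pos: "0 < Di - Dj" by simp
    define g where "g x = f i (y i + x) + f j (y j - x)" for x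
    have "((\<lambda>x. f i (y i + x)) has_real_derivative Di) (at 0)"
      using DERIV_shift[of "f i" Di 0 "y i"] D(1) by (simp add: add.commute)
    moreover have "((\<lambda>x. f j (y j - x)) has_real_derivative Dj * - 1) (at 0)"
      by (rule DERIV_chain2[where f="f j"]) (auto intro!: derivative_eq_intros D(2))
    ultimately have "(g has_real_derivative (Di - Dj)) (at 0)"
      unfolding g_def using DERIV_add by fastforce
    from DERIV_pos_inc_right[OF this pos] obtain d
      where d: "0 < d" "\<And>h. 0 < h \<Longrightarrow> h < d \<Longrightarrow> g 0 < g (0 + h)" by blast
    \<comment> \<open>Halving \<open>d\<close> makes \<open>h < d\<close> strict; the bound
      \<open>y j\<close> keeps the donating coordinate nonnegative.\<close>
    define h where "h = min (d / 2) (y j)"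
    have h: "0 < h" "h < d" "h \<le> y j" using d(1) ij(3) by (auto simp: h_def)
    define z where "z = y(i := y i + h, j := y j - h)"
    have "sum z I = sum y I"
      using sum_change_two[OF fin ij(1,2) False, of z y] False by (auto simp: z_def)
    moreover have "0 \<le> z k" if "k \<in> I" for k
      using y[OF that] y[OF ij(1)] h that by (auto simp: z_def)
    ultimately have "(\<Sum>i\<in>I. f i (z i)) \<le> (\<Sum>i\<in>I. f i (y i))" by (intro opt) auto
    moreover have "(\<Sum>i\<in>I. f i (z i)) = (\<Sum>i\<in>I. f i (y i)) - g 0 + g h"
      using sum_change_two[OF fin ij(1,2) False, of "\<lambda>i. f i (z i)" "\<lambda>i. f i (y i)"] False
      by (auto simp: z_def g_def)
    ultimately show False using d(2)[of h] h by simp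
  qed
qed

text \<open>The multiplier is the derivative at any coordinate carrying mass; a positive total
  supplies one. Between two such coordinates the exchange works in both directions, whence
  equality.\<close>

lemma simplex_multiplier:
  fixes y :: "'a \<Rightarrow> real"
  assumes "finite I" "\<And>i. i \<in> I \<Longrightarrow> 0 \<le> y i"
    and "\<And>z. (\<And>i. i \<in> I \<Longrightarrow> 0 \<le> z i) \<Longrightarrow> sum z I = sum y I \<Longrightarrow>
               (\<Sum>i\<in>I. f i (z i)) \<le> (\<Sum>i\<in>I. f i (y i))"
    and D: "\<And>i. i \<in> I \<Longrightarrow> (f i has_real_derivative D i) (at (y i))"
    and "0 < sum y I"
  obtains v where "\<And>i. i \<in> I \<Longrightarrow> D i \<le> v" "\<And>i. i \<in> I \<Longrightarrow> 0 < y i \<Longrightarrow> D i = v"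
proof -
  obtain j where j: "j \<in> I" "0 < y j"
    using assms(5) sum_nonpos[of I y] by (meson not_le)
  have le: "D i \<le> D k" if "i \<in> I" "k \<in> I" "0 < y k" for i k
    by (rule simplex_exchange[of I y f i k]) (use assms that in auto)
  show ?thesis by (rule that[of "D j"]) (use le j in \<open>auto intro: antisym\<close>)
qed

section \<open>Tie-breaking between equal gains\<close>

text \<open>Among the permutations preserving \<open>m\<close>, take one minimizing the sum of the
  positions where \<open>p\<close> composed with it is nonzero. An empty position \<open>r\<close>
  before an occupied \<open>s\<close> with the same \<open>m\<close> could be swapped with it,
  lowering this sum by \<open>s - r\<close>.\<close>

lemma permutation_moving_support_first:
  fixes m :: "nat \<Rightarrow> 'a" and p :: "nat \<Rightarrow> real"
  obtains \<sigma> where "\<sigma> permutes {1..n}" "\<And>s. s \<in> {1..n} \<Longrightarrow> m (\<sigma> s) = m s"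
    "\<And>r s. r \<in> {1..n} \<Longrightarrow> s \<in> {1..n} \<Longrightarrow> r < s \<Longrightarrow> m r = m s \<Longrightarrow> p (\<sigma> s) \<noteq> 0 \<Longrightarrow> p (\<sigma> r) \<noteq> 0"
proof -
  define Q where "Q = {\<sigma>. \<sigma> permutes {1..n} \<and> (\<forall>s\<in>{1..n}. m (\<sigma> s) = m s)}"
  define f where "f \<sigma> k = (if p (\<sigma> k) \<noteq> 0 then real k else 0)" for \<sigma> k
  have "finite Q" unfolding Q_def
    by (rule finite_subset[OF _ finite_permutations[of "{1..n}"]]) auto
  moreover have "id \<in> Q" by (simp add: Q_def permutes_id)
  ultimately obtain \<sigma> where "is_arg_min (\<lambda>\<sigma>. sum (f \<sigma>) {1..n}) (\<lambda>\<sigma>. \<sigma> \<in> Q) \<sigma>"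
    using ex_is_arg_min_if_finite[of Q "\<lambda>\<sigma>. sum (f \<sigma>) {1..n}"] by blast
  then have Q: "\<sigma> \<in> Q" and min: "\<And>\<tau>. \<tau> \<in> Q \<Longrightarrow> sum (f \<sigma>) {1..n} \<le> sum (f \<tau>) {1..n}"
    by (auto simp: is_arg_min_linorder)
  show ?thesis
  proof (rule that)
    show \<sigma>: "\<sigma> permutes {1..n}" "\<And>s. s \<in> {1..n} \<Longrightarrow> m (\<sigma> s) = m s" using Q by (auto simp: Q_def)
    fix r s
    assume rs: "r \<in> {1..n}" "s \<in> {1..n}" "r < s" "m r = m s" "p (\<sigma> s) \<noteq> 0"
    show "p (\<sigma> r) \<noteq> 0"
    proof
      assume r0: "p (\<sigma> r) = 0"
      define \<tau> where "\<tau> = \<sigma> \<circ> Transposition.transpose r s"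
      have "\<tau> permutes {1..n}"
        unfolding \<tau>_def by (rule permutes_compose[OF permutes_swap_id[OF rs(1,2)] \<sigma>(1)])
      moreover have "m (\<tau> k) = m k" if "k \<in> {1..n}" for k
        using that \<sigma>(2) rs by (auto simp: \<tau>_def Transposition.transpose_def)
      ultimately have "\<tau> \<in> Q" by (simp add: Q_def)
      moreover have "sum (f \<tau>) {1..n} = sum (f \<sigma>) {1..n} - f \<sigma> r - f \<sigma> s + f \<tau> r + f \<tau> s"
        by (rule sum_change_two) (use rs in \<open>auto simp: f_def \<tau>_def Transposition.transpose_def\<close>)
      moreover have "f \<sigma> r = 0" "f \<sigma> s = s" "f \<tau> r = r" "f \<tau> s = 0"
        using rs r0 by (auto simp: f_def \<tau>_def)
      ultimately show False using min[of \<tau>] rs(3) by simp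
    qed
  qed
qed

section \<open>The KKT conditions of (P3)\<close>

locale cascaded_channel =
  fixes S L :: nat and P :: real and mr md :: "nat \<Rightarrow> real"
  assumes S: "1 \<le> S" and L: "1 \<le> L" and P: "0 < P"
    and mr: "\<And>s. s \<in> {1..S} \<Longrightarrow> 0 < mr s" and mr_mono: "antimono_on {1..S} mr"
    and md: "\<And>i. i \<in> {1..L} \<Longrightarrow> 0 < md i" and md_mono: "antimono_on {1..L} md"
begin

abbreviation "feasible \<equiv> P3_feasible S L P"
abbreviation "optimal \<equiv> P3_optimal S L P mr md"
abbreviation "objective \<equiv> P3_objective S L mr md"
abbreviation "dual_variables \<equiv> P3_dual_variables S L P mr md"

lemma feasibleD:
  assumes "feasible pr pd t"
  shows "\<And>s. s \<in> {1..S} \<Longrightarrow> 0 \<le> pr s" "\<And>s. s \<in> {1..S} \<Longrightarrow> 0 \<le> t s"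
    "\<And>i. i \<in> {1..L} \<Longrightarrow> 0 \<le> pd i" "sum pr {1..S} + sum pd {1..L} = P" "sum t {1..S} = 1"
  using assms by (auto simp: P3_feasible_def)

lemma snr_nonneg:
  assumes "feasible pr pd t" "s \<in> {1..S}"
  shows "0 \<le> mr s * pr s * (t s)\<^sup>2"
  using feasibleD(1)[OF assms] mr[OF assms(2)] by simp

text \<open>The derivative is two-sided even on the boundary \<open>pr s = 0\<close>: at a feasible
  point the argument of \<open>ln\<close> is at least 1, hence it stays positive nearby.\<close>

lemma lagrangian_derivative_pr:
  assumes "feasible pr pd t" "s \<in> {1..S}"
  shows "((\<lambda>x. P3_lagrangian S L P mr md lr ld v \<mu> w (pr(s := x)) pd t) has_real_derivative
     v - lr s - mr s * (t s)\<^sup>2 / (1 + mr s * pr s * (t s)\<^sup>2)) (at (pr s))"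
proof -
  note [simp] = snr_nonneg[OF assms]
  have a: "((\<lambda>x. \<Sum>k = 1..S. ln (1 + mr k * (pr(s := x)) k * (t k)\<^sup>2)) has_real_derivative
      mr s * (t s)\<^sup>2 / (1 + mr s * pr s * (t s)\<^sup>2)) (at (pr s))"
    by (rule has_real_derivative_sum_fun_upd[where F="\<lambda>k y. ln (1 + mr k * y * (t k)\<^sup>2)"])
      (use assms in \<open>auto intro!: derivative_eq_intros simp: add_pos_nonneg\<close>)
  have b: "((\<lambda>x. \<Sum>k = 1..S. lr k * (pr(s := x)) k) has_real_derivative lr s) (at (pr s))"
    by (rule has_real_derivative_sum_fun_upd[where F="\<lambda>k y. lr k * y"])
      (use assms in \<open>auto intro!: derivative_eq_intros\<close>)
  have c: "((\<lambda>x. \<Sum>k = 1..S. (pr(s := x)) k) has_real_derivative 1) (at (pr s))"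
    by (rule has_real_derivative_sum_fun_upd[where F="\<lambda>k y. y"])
      (use assms in \<open>auto intro!: derivative_eq_intros\<close>)
  show ?thesis unfolding P3_lagrangian_def P3_objective_def
    by (rule derivative_eq_intros a b c refl | simp)+
qed

lemma lagrangian_derivative_pd:
  assumes "feasible pr pd t" "s \<in> {1..L}"
  shows "((\<lambda>x. P3_lagrangian S L P mr md lr ld v \<mu> w pr (pd(s := x)) t) has_real_derivative
     v - ld s - md s / (1 + md s * pd s)) (at (pd s))"
proof -
  have [simp]: "0 \<le> md s * pd s" using feasibleD(3)[OF assms] md[OF assms(2)] by simp
  have a: "((\<lambda>x. \<Sum>k = 1..L. ln (1 + md k * (pd(s := x)) k)) has_real_derivative
      md s / (1 + md s * pd s)) (at (pd s))"
    by (rule has_real_derivative_sum_fun_upd[where F="\<lambda>k y. ln (1 + md k * y)"])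
      (use assms in \<open>auto intro!: derivative_eq_intros simp: add_pos_nonneg\<close>)
  have b: "((\<lambda>x. \<Sum>k = 1..L. ld k * (pd(s := x)) k) has_real_derivative ld s) (at (pd s))"
    by (rule has_real_derivative_sum_fun_upd[where F="\<lambda>k y. ld k * y"])
      (use assms in \<open>auto intro!: derivative_eq_intros\<close>)
  have c: "((\<lambda>x. \<Sum>k = 1..L. (pd(s := x)) k) has_real_derivative 1) (at (pd s))"
    by (rule has_real_derivative_sum_fun_upd[where F="\<lambda>k y. y"])
      (use assms in \<open>auto intro!: derivative_eq_intros\<close>)
  show ?thesis unfolding P3_lagrangian_def P3_objective_def
    by (rule derivative_eq_intros a b c refl | simp)+
qed

lemma lagrangian_derivative_t:
  assumes "feasible pr pd t" "s \<in> {1..S}"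
  shows "((\<lambda>x. P3_lagrangian S L P mr md lr ld v \<mu> w pr pd (t(s := x))) has_real_derivative
     w - \<mu> s - 2 * mr s * pr s * t s / (1 + mr s * pr s * (t s)\<^sup>2)) (at (t s))"
proof -
  note [simp] = snr_nonneg[OF assms]
  have a: "((\<lambda>x. \<Sum>k = 1..S. ln (1 + mr k * pr k * ((t(s := x)) k)\<^sup>2)) has_real_derivative
      2 * mr s * pr s * t s / (1 + mr s * pr s * (t s)\<^sup>2)) (at (t s))"
    by (rule has_real_derivative_sum_fun_upd[where F="\<lambda>k y. ln (1 + mr k * pr k * y\<^sup>2)"])
      (use assms in \<open>auto intro!: derivative_eq_intros simp: add_pos_nonneg\<close>)
  have b: "((\<lambda>x. \<Sum>k = 1..S. \<mu> k * (t(s := x)) k) has_real_derivative \<mu> s) (at (t s))"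
    by (rule has_real_derivative_sum_fun_upd[where F="\<lambda>k y. \<mu> k * y"])
      (use assms in \<open>auto intro!: derivative_eq_intros\<close>)
  have c: "((\<lambda>x. \<Sum>k = 1..S. (t(s := x)) k) has_real_derivative 1) (at (t s))"
    by (rule has_real_derivative_sum_fun_upd[where F="\<lambda>k y. y"])
      (use assms in \<open>auto intro!: derivative_eq_intros\<close>)
  show ?thesis unfolding P3_lagrangian_def P3_objective_def
    by (rule derivative_eq_intros a b c refl | simp)+
qed

text \<open>Stationarity determines each multiplier of a sign constraint as \<open>v\<close> or
  \<open>w\<close> minus a marginal rate. Substituting it turns its sign into an inequality and
  complementary slackness into equality on active coordinates, so only \<open>v\<close> and
  \<open>w\<close> remain.\<close>

lemma dual_variables_iff:
  assumes feas: "feasible pr pd t"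
  shows "dual_variables pr pd t v w \<longleftrightarrow>
    (\<forall>s\<in>{1..S}. mr s * (t s)\<^sup>2 / (1 + mr s * pr s * (t s)\<^sup>2) \<le> v \<and>
       (0 < pr s \<longrightarrow> mr s * (t s)\<^sup>2 / (1 + mr s * pr s * (t s)\<^sup>2) = v)) \<and>
    (\<forall>i\<in>{1..L}. md i / (1 + md i * pd i) \<le> v \<and> (0 < pd i \<longrightarrow> md i / (1 + md i * pd i) = v)) \<and>
    (\<forall>s\<in>{1..S}. 2 * mr s * pr s * t s / (1 + mr s * pr s * (t s)\<^sup>2) \<le> w \<and>
       (0 < t s \<longrightarrow> 2 * mr s * pr s * t s / (1 + mr s * pr s * (t s)\<^sup>2) = w))" (is "_ \<longleftrightarrow> ?rhs")
proof -
  have zero: "(f has_real_derivative 0) (at x) \<longleftrightarrow> D = 0"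
    if "(f has_real_derivative D) (at x)" for f D and x :: real
    using that DERIV_unique by blast
  have kkt: "P3_KKT S L P mr md lr ld v \<mu> w pr pd t \<longleftrightarrow>
     (\<forall>s\<in>{1..S}. 0 \<le> lr s \<and> lr s * pr s = 0 \<and>
        v - lr s - mr s * (t s)\<^sup>2 / (1 + mr s * pr s * (t s)\<^sup>2) = 0) \<and>
     (\<forall>i\<in>{1..L}. 0 \<le> ld i \<and> ld i * pd i = 0 \<and> v - ld i - md i / (1 + md i * pd i) = 0) \<and>
     (\<forall>s\<in>{1..S}. 0 \<le> \<mu> s \<and> \<mu> s * t s = 0 \<and>
        w - \<mu> s - 2 * mr s * pr s * t s / (1 + mr s * pr s * (t s)\<^sup>2) = 0)"
    (is "_ \<longleftrightarrow> (\<forall>s\<in>{1..S}. ?A s \<and> ?B s \<and> ?DP s = 0) \<and> (\<forall>i\<in>{1..L}. ?A' i \<and> ?B' i \<and> ?DD i = 0) \<and>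
      (\<forall>s\<in>{1..S}. ?A'' s \<and> ?B'' s \<and> ?DT s = 0)")
    for lr ld \<mu>
  proof -
    let ?\<L> = "P3_lagrangian S L P mr md lr ld v \<mu> w"
    have "(\<forall>s\<in>{1..S}. ((\<lambda>x. ?\<L> (pr(s := x)) pd t) has_real_derivative 0) (at (pr s)))
        \<longleftrightarrow> (\<forall>s\<in>{1..S}. ?DP s = 0)"
      "(\<forall>i\<in>{1..L}. ((\<lambda>x. ?\<L> pr (pd(i := x)) t) has_real_derivative 0) (at (pd i)))
        \<longleftrightarrow> (\<forall>i\<in>{1..L}. ?DD i = 0)"
      "(\<forall>s\<in>{1..S}. ((\<lambda>x. ?\<L> pr pd (t(s := x))) has_real_derivative 0) (at (t s)))
        \<longleftrightarrow> (\<forall>s\<in>{1..S}. ?DT s = 0)"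
      by (intro ball_cong refl zero lagrangian_derivative_pr lagrangian_derivative_pd
          lagrangian_derivative_t feas; assumption)+
    then show ?thesis
      unfolding P3_KKT_def ball_conj_distrib using feas by argo
  qed
  show ?thesis
  proof
    assume "dual_variables pr pd t v w"
    then obtain lr ld \<mu> where "P3_KKT S L P mr md lr ld v \<mu> w pr pd t"
      unfolding P3_dual_variables_def by blast
    note K = this[unfolded kkt]
    show ?rhs using K by (auto simp del: mult_eq_0_iff)
  next
    assume R: ?rhs
    have slack: "0 \<le> v - X \<and> (v - X) * p = 0 \<and> v - (v - X) - X = 0"
      if "X \<le> v \<and> (0 < p \<longrightarrow> X = v)" "0 \<le> p" for X v p :: real
      using that by (auto simp: le_less)
    have "P3_KKT S L P mr md
       (\<lambda>s. v - mr s * (t s)\<^sup>2 / (1 + mr s * pr s * (t s)\<^sup>2)) (\<lambda>i. v - md i / (1 + md i * pd i)) v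
       (\<lambda>s. w - 2 * mr s * pr s * t s / (1 + mr s * pr s * (t s)\<^sup>2)) w pr pd t"
      unfolding kkt using R by (intro conjI ballI slack; simp add: feasibleD[OF feas])
    then show "dual_variables pr pd t v w" unfolding P3_dual_variables_def by blast
  qed
qed

text \<open>The power budget is shared by cascaded and direct paths, so the first simplex is indexed
  by the disjoint sum of both index sets and yields \<open>v\<close>. The time simplex, with the
  powers held fixed, yields \<open>w\<close>.\<close>

lemma optimal_dual_variables:
  assumes "optimal pr pd t"
  obtains v w where "dual_variables pr pd t v w"
proof -
  have feas: "feasible pr pd t" 
    and opt: "\<And>pr' pd' t'. feasible pr' pd' t' \<Longrightarrow> objective pr' pd' t' \<le> objective pr pd t"
    using assms by (auto simp: P3_optimal_def)
  note F = feasibleD[OF feas]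
  define f where "f = case_sum (\<lambda>s x. ln (1 + mr s * x * (t s)\<^sup>2)) (\<lambda>i x. ln (1 + md i * x))"
  define D where "D = case_sum (\<lambda>s. mr s * (t s)\<^sup>2 / (1 + mr s * pr s * (t s)\<^sup>2))
    (\<lambda>i. md i / (1 + md i * pd i))"
  let ?I = "{1..S} <+> {1..L}" and ?y = "case_sum pr pd"
  obtain v where v: "\<And>i. i \<in> ?I \<Longrightarrow> D i \<le> v" "\<And>i. i \<in> ?I \<Longrightarrow> 0 < ?y i \<Longrightarrow> D i = v"
  proof (rule simplex_multiplier[of ?I ?y f D])
    show "0 \<le> ?y i" if "i \<in> ?I" for i using that F(1,3) by auto
    show "(f i has_real_derivative D i) (at (?y i))" if "i \<in> ?I" for i
    proof (cases i)
      case (Inl s)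
      then have "0 \<le> mr s * pr s * (t s)\<^sup>2" using that snr_nonneg[OF feas] by auto
      then show ?thesis using Inl
        by (auto simp: f_def D_def intro!: derivative_eq_intros add_pos_nonneg)
    next
      case (Inr k)
      then have "0 \<le> md k * pd k" using that F(3)[of k] md[of k] by auto
      then show ?thesis using Inr
        by (auto simp: f_def D_def intro!: derivative_eq_intros add_pos_nonneg)
    qed
    show "0 < sum ?y ?I" using F(4) P by (simp add: sum.Plus o_def)
    fix z :: "nat + nat \<Rightarrow> real"
    assume z: "\<And>i. i \<in> ?I \<Longrightarrow> 0 \<le> z i" "sum z ?I = sum ?y ?I"
    have "feasible (z \<circ> Inl) (z \<circ> Inr) t"
      using z F by (auto simp: P3_feasible_def sum.Plus o_def)
    from opt[OF this] show "(\<Sum>i\<in>?I. f i (z i)) \<le> (\<Sum>i\<in>?I. f i (?y i))"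
      by (simp add: sum.Plus o_def f_def P3_objective_def)
  qed auto
  let ?g = "\<lambda>s x. ln (1 + mr s * pr s * x\<^sup>2)"
    and ?E = "\<lambda>s. 2 * mr s * pr s * t s / (1 + mr s * pr s * (t s)\<^sup>2)"
  obtain w where w: "\<And>s. s \<in> {1..S} \<Longrightarrow> ?E s \<le> w" "\<And>s. s \<in> {1..S} \<Longrightarrow> 0 < t s \<Longrightarrow> ?E s = w"
  proof (rule simplex_multiplier[of "{1..S}" t ?g ?E])
    show "(?g s has_real_derivative ?E s) (at (t s))" if "s \<in> {1..S}" for s
      using snr_nonneg[OF feas that]
      by (auto intro!: derivative_eq_intros add_pos_nonneg)
    fix z :: "nat \<Rightarrow> real"
    assume z: "\<And>s. s \<in> {1..S} \<Longrightarrow> 0 \<le> z s" "sum z {1..S} = sum t {1..S}"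
    have "feasible pr pd z" using z F by (auto simp: P3_feasible_def)
    from opt[OF this] show "(\<Sum>s\<in>{1..S}. ?g s (z s)) \<le> (\<Sum>s\<in>{1..S}. ?g s (t s))"
      by (simp add: P3_objective_def)
  qed (use F in auto)
  have "dual_variables pr pd t v w"
    unfolding dual_variables_iff[OF feas]
    using v[OF InlI] v[OF InrI] w by (auto simp: D_def)
  then show ?thesis by (rule that)
qed

section \<open>Active cascaded paths\<close>

text \<open>The summands of all other paths cancel, and exponentiating leaves a polynomial
  inequality. It serves both for merging two paths and for swapping them.\<close>

lemma optimal_two_paths:
  assumes "optimal pr pd t" and rs: "r \<in> {1..S}" "s \<in> {1..S}" "r \<noteq> s"
    and "0 \<le> p" "0 \<le> p'" "0 \<le> u" "0 \<le> u'" "p + p' = pr r + pr s" "u + u' = t r + t s"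
  shows "(1 + mr r * p * u\<^sup>2) * (1 + mr s * p' * u'\<^sup>2) \<le>
         (1 + mr r * pr r * (t r)\<^sup>2) * (1 + mr s * pr s * (t s)\<^sup>2)"
proof -
  have feas: "feasible pr pd t" using assms(1) by (auto simp: P3_optimal_def)
  note F = feasibleD[OF feas]
  let ?pr = "pr(r := p, s := p')" and ?t = "t(r := u, s := u')"
  have "sum ?pr {1..S} = sum pr {1..S}"
    using sum_change_two[OF _ rs, of ?pr pr] assms by auto
  moreover have "sum ?t {1..S} = sum t {1..S}"
    using sum_change_two[OF _ rs, of ?t t] assms by auto
  ultimately have "feasible ?pr pd ?t" using F assms by (auto simp: P3_feasible_def)
  then have "objective ?pr pd ?t \<le> objective pr pd t"
    using assms(1) by (auto simp: P3_optimal_def)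
  then have "ln (1 + mr r * p * u\<^sup>2) + ln (1 + mr s * p' * u'\<^sup>2) \<le>
         ln (1 + mr r * pr r * (t r)\<^sup>2) + ln (1 + mr s * pr s * (t s)\<^sup>2)"
    using sum_change_two[OF _ rs, of "\<lambda>k. ln (1 + mr k * ?pr k * (?t k)\<^sup>2)"
        "\<lambda>k. ln (1 + mr k * pr k * (t k)\<^sup>2)"] rs(3)
    by (simp add: P3_objective_def)
  moreover have pos: "0 < 1 + mr r * p * u\<^sup>2" "0 < 1 + mr s * p' * u'\<^sup>2"
    "0 < 1 + mr r * pr r * (t r)\<^sup>2" "0 < 1 + mr s * pr s * (t s)\<^sup>2"
    using assms(5-8) mr[OF rs(1)] mr[OF rs(2)] F(1)[OF rs(1)] F(1)[OF rs(2)]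
    by (auto intro!: add_pos_nonneg)
  ultimately show ?thesis by (simp flip: ln_mult_pos)
qed

text \<open>The first direct path has a positive marginal rate, which bounds \<open>v\<close> away
  from 0. The power equation of an active cascaded path then excludes \<open>t s = 0\<close>, and
  with \<open>t s > 0\<close> the time equation gives \<open>w > 0\<close>.\<close>

lemma active_path_dual_eqs:
  assumes dual: "dual_variables pr pd t v w" and feas: "feasible pr pd t"
    and s: "s \<in> {1..S}" "0 < pr s"
  shows "0 < t s" "0 < v" "0 < w"
    "v = mr s * (t s)\<^sup>2 / (1 + mr s * pr s * (t s)\<^sup>2)"
    "w = 2 * mr s * pr s * t s / (1 + mr s * pr s * (t s)\<^sup>2)"
proof -
  note D = dual[unfolded dual_variables_iff[OF feas]]
  have one: "1 \<in> {1..L}" using L by simp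
  have "0 < md 1 / (1 + md 1 * pd 1)"
    using md[OF one] feasibleD(3)[OF feas one] by (auto intro!: divide_pos_pos add_pos_nonneg)
  also have "\<dots> \<le> v" using D one by blast
  finally show v: "0 < v" .
  show v': "v = mr s * (t s)\<^sup>2 / (1 + mr s * pr s * (t s)\<^sup>2)" using D s by simp
  then have "t s \<noteq> 0" using v by auto
  then show t: "0 < t s" using feasibleD(2)[OF feas s(1)] by simp
  show w': "w = 2 * mr s * pr s * t s / (1 + mr s * pr s * (t s)\<^sup>2)" using D s t by simp
  show "0 < w" unfolding w' using mr[OF s(1)] s(2) t
    by (auto intro!: divide_pos_pos add_pos_nonneg)
qed

text \<open>A time share without power has marginal rate 0, whereas an active path \<open>r\<close>
  forces \<open>w > 0\<close>.\<close>

lemma t_pos_imp_pr_pos: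
  assumes dual: "dual_variables pr pd t v w" and feas: "feasible pr pd t"
    and "r \<in> {1..S}" "0 < pr r" and s: "s \<in> {1..S}" "0 < t s"
  shows "0 < pr s"
proof -
  have "2 * mr s * pr s * t s / (1 + mr s * pr s * (t s)\<^sup>2) = w"
    using dual[unfolded dual_variables_iff[OF feas]] s by blast
  then have "pr s \<noteq> 0" using active_path_dual_eqs(3)[OF assms(1-4)] by auto
  then show ?thesis using feasibleD(1)[OF feas s(1)] by simp
qed

text \<open>The equations for \<open>v\<close> and \<open>w\<close> have the same denominator, which
  cancels in their quotient.\<close>

lemma active_t_eq:
  assumes dual: "dual_variables pr pd t v w" and feas: "feasible pr pd t"
    and s: "s \<in> {1..S}" "0 < pr s"
  shows "t s = 2 * v / w * pr s"
proof -
  note K = active_path_dual_eqs[OF assms]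
  have pos: "0 < 1 + mr s * pr s * (t s)\<^sup>2"
    using snr_nonneg[OF feas s(1)] by (simp add: add_pos_nonneg)
  have "w * t s = 2 * v * pr s" unfolding K(4,5) by (simp add: power2_eq_square)
  then show ?thesis using K(3) by (simp add: field_simps)
qed

text \<open>
  If the ratio were at most 2, handing the power and time share of path \<open>s\<close> to path \<open>r\<close> would
  improve the objective, because the signal-to-noise ratio is cubic in the power along \<open>t s = 2 * v / w * pr s\<close>.
\<close>

lemma active_snr_gt_2:
  assumes opt: "optimal pr pd t"
    and s: "s \<in> {1..S}" "0 < pr s" and r: "r \<in> {1..S}" "0 < pr r" and "r \<noteq> s"
  shows "2 < mr s * pr s * (t s)\<^sup>2"
proof -
  have feas: "feasible pr pd t" using opt by (auto simp: P3_optimal_def)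
  obtain v w where dual: "dual_variables pr pd t v w" using optimal_dual_variables[OF opt] .
  note Ks = active_path_dual_eqs[OF dual feas s] and Kr = active_path_dual_eqs[OF dual feas r]
  \<comment> \<open>Since both paths have the ratio \<open>2 * v / w\<close> of time to power, so
    does the merged path; hence the same \<open>b\<close> gives its signal-to-noise ratio as
    \<open>b\<close> times the cube of the total power.\<close>
  define b where "b = mr r * (2 * v / w)\<^sup>2"
  define xs where "xs = mr s * pr s * (t s)\<^sup>2"
  define xr where "xr = mr r * pr r * (t r)\<^sup>2"
  note ts = active_t_eq[OF dual feas s] and tr = active_t_eq[OF dual feas r]
  have b: "0 < b" unfolding b_def using mr[OF r(1)] Ks(2,3) by simp
  have xs: "0 < xs" unfolding xs_def using mr[OF s(1)] s Ks(1) by simp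
  have xr: "0 < xr" unfolding xr_def using mr[OF r(1)] r Kr(1) by simp
  have xr_b: "xr = b * pr r ^ 3" unfolding xr_def b_def tr
    by (simp add: power2_eq_square power3_eq_cube)
  have vs: "v * pr s * (1 + xs) = xs"
    using xs unfolding Ks(4) xs_def[symmetric] by (simp add: xs_def field_simps)
  have vr: "v * pr r * (1 + xr) = xr"
    using xr unfolding Kr(4) xr_def[symmetric] by (simp add: xr_def field_simps)
  have "(1 + mr r * (pr r + pr s) * (t r + t s)\<^sup>2) * (1 + mr s * 0 * 0\<^sup>2) \<le> (1 + xr) * (1 + xs)"
    unfolding xr_def xs_def
    by (rule optimal_two_paths[OF opt r(1) s(1) \<open>r \<noteq> s\<close>]) (use r s Ks(1) Kr(1) in auto)
  moreover have "mr r * (pr r + pr s) * (t r + t s)\<^sup>2 = b * (pr r + pr s) ^ 3"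
  proof -
    have "t r + t s = 2 * v / w * (pr r + pr s)" unfolding ts tr by (simp only: distrib_left)
    then show ?thesis by (simp only: b_def power2_eq_square power3_eq_cube mult_ac)
  qed
  ultimately have le: "b * (pr r + pr s) ^ 3 \<le> xr + xs * (1 + xr)" by (simp add: algebra_simps)
  have "b * (pr r + pr s) ^ 3 =
      xr + 3 * b * (pr r)\<^sup>2 * pr s + b * (3 * pr r * (pr s)\<^sup>2 + pr s ^ 3)"
    unfolding xr_b by (simp add: power2_eq_square power3_eq_cube algebra_simps)
  moreover have "0 < b * (3 * pr r * (pr s)\<^sup>2 + pr s ^ 3)"
    using b r(2) s(2) by (intro mult_pos_pos add_pos_pos) auto
  \<comment> \<open>Of the binomial expansion only the term linear in \<open>pr s\<close> is kept;
    its coefficient 3 is the origin of the bound 2.\<close>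
  ultimately have "3 * b * (pr r)\<^sup>2 * pr s < xs * (1 + xr)" using le by linarith
  \<comment> \<open>The factor \<open>v * pr r\<close> makes \<open>xr\<close> appear on both sides,
    by \<open>xr_b\<close> on the left and by \<open>vr\<close> on the right. Cancelling it leaves
    \<open>3 * (v * pr s) < xs\<close>, and \<open>vs\<close> turns this into
    \<open>3 < 1 + xs\<close>.\<close>
  then have "(v * pr r) * (3 * b * (pr r)\<^sup>2 * pr s) < (v * pr r) * (xs * (1 + xr))"
    using Ks(2) r(2) by (intro mult_strict_left_mono) auto
  also have "\<dots> = xs * xr" by (subst vr[symmetric]) (simp add: algebra_simps)
  also have "(v * pr r) * (3 * b * (pr r)\<^sup>2 * pr s) = (3 * (v * pr s)) * xr"
    unfolding xr_b by (simp add: power2_eq_square power3_eq_cube)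
  finally have "3 * (v * pr s) < xs" using xr by simp
  also have "\<dots> = (1 + xs) * (v * pr s)" using vs by (simp add: algebra_simps)
  finally have "3 < 1 + xs" using Ks(2) s(2) by (simp add: mult_less_cancel_right)
  then show ?thesis by (simp add: xs_def)
qed

section \<open>The order of activation\<close>

text \<open>An idle path \<open>r\<close> could take over the power and time share of
  \<open>s\<close>, so optimality gives \<open>mr r \<le> mr s\<close>. By monotonicity the gains
  are equal, and this is the tie that \<open>normalized\<close> decides.\<close>

lemma active_before_active:
  assumes opt: "optimal pr pd t" and norm: "normalized S mr pr t"
    and r: "r \<in> {1..S}" and s: "s \<in> {1..S}" "0 < pr s" and "r < s"
  shows "0 < pr r"
proof (rule ccontr)
  assume *: "\<not> 0 < pr r"
  have feas: "feasible pr pd t" using opt by (auto simp: P3_optimal_def)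
  obtain v w where dual: "dual_variables pr pd t v w" using optimal_dual_variables[OF opt] .
  have "\<not> 0 < t r" using t_pos_imp_pr_pos[OF dual feas s r] * by blast
  then have r0: "pr r = 0" "t r = 0" using * feasibleD(1,2)[OF feas r] by simp_all
  have ts: "0 < t s" using active_path_dual_eqs[OF dual feas s] by simp
  have "(1 + mr r * pr s * (t s)\<^sup>2) * (1 + mr s * pr r * (t r)\<^sup>2) \<le>
        (1 + mr r * pr r * (t r)\<^sup>2) * (1 + mr s * pr s * (t s)\<^sup>2)"
    by (rule optimal_two_paths[OF opt r s(1)]) (use \<open>r < s\<close> r0 s ts in auto)
  then have "mr r \<le> mr s" using r0 s ts by simp
  moreover have "mr s \<le> mr r" using monotone_onD[OF mr_mono r s(1)] \<open>r < s\<close> by simp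
  ultimately show False using norm r s \<open>r < s\<close> r0 unfolding normalized_def
    by (metis antisym less_irrefl)
qed

text \<open>The marginal rate of an idle path is its full gain, that of an active path is
  \<open>v\<close> and strictly below its gain. The strictness covers equal gains as well.\<close>

lemma direct_before_active:
  assumes dual: "dual_variables pr pd t v w" and feas: "feasible pr pd t"
    and i: "i \<in> {1..L}" and j: "j \<in> {1..L}" "0 < pd j" and "i < j"
  shows "0 < pd i"
proof (rule ccontr)
  assume "\<not> 0 < pd i"
  then have "pd i = 0" using feasibleD(3)[OF feas i] by simp
  then have "md i \<le> v" using dual[unfolded dual_variables_iff[OF feas]] i by fastforce
  also have "v = md j / (1 + md j * pd j)"
    using dual[unfolded dual_variables_iff[OF feas]] j by fastforce
  also have "\<dots> < md j" using md[OF j(1)] j(2) by (simp add: divide_less_eq add_pos_pos)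
  also have "\<dots> \<le> md i" using monotone_onD[OF md_mono i j(1)] \<open>i < j\<close> by simp
  finally show False by simp
qed

section \<open>The shape of an optimal solution\<close>

text \<open>With all time on path 1 its effective gain is \<open>mr 1\<close>, and the power
  conditions at the common level \<open>v\<close> are those of ordinary water-filling, including the
  case \<open>pr 1 = 0\<close>.\<close>

lemma single_path_solution:
  assumes dual: "dual_variables pr pd t v w" and feas: "feasible pr pd t"
    and zero: "\<And>s. s \<in> {2..S} \<Longrightarrow> pr s = 0 \<and> t s = 0"
  shows "single_path_water_filling S L P mr md pr pd t"
proof -
  note D = dual[unfolded dual_variables_iff[OF feas]]
  have one: "1 \<in> {1..S}" "1 \<in> {1..L}" using S L by auto
  have "{1..S} = insert 1 {2..S}" using S by auto
  then have t1: "t 1 = 1" using feasibleD(5)[OF feas] zero by simp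
  note W = water_level_solution[OF mr[OF one(1)] feasibleD(1)[OF feas one(1)], of v]
  have pr1: "mr 1 / (1 + mr 1 * pr 1) \<le> v \<and> (0 < pr 1 \<longrightarrow> mr 1 / (1 + mr 1 * pr 1) = v)"
    using D one(1) t1 by fastforce
  have "pd i = max 0 (1 / v - 1 / md i)" if i: "i \<in> {1..L}" for i
    by (rule water_level_solution[OF md[OF i] feasibleD(3)[OF feas i]]) (use D i in auto)
  then show ?thesis
    unfolding single_path_water_filling_def using W pr1 t1 zero feasibleD(4)[OF feas] by blast
qed

lemma multi_path_solution:
  assumes opt: "optimal pr pd t" and dual: "dual_variables pr pd t v w"
    and rs: "r \<in> {1..S}" "0 < pr r" "s \<in> {1..S}" "0 < pr s" "r \<noteq> s"
  shows "multi_path_system S P mr md {s \<in> {1..S}. 0 < pr s} {i \<in> {1..L}. 0 < pd i} v w pr pd t"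
    (is "multi_path_system S P mr md ?A ?B v w pr pd t")
proof -
  have feas: "feasible pr pd t" using opt by (auto simp: P3_optimal_def)
  note F = feasibleD[OF feas] and D = dual[unfolded dual_variables_iff[OF feas]]
  have zero: "pr k = 0 \<and> t k = 0" if "k \<in> {1..S} - ?A" for k
  proof -
    have "\<not> 0 < t k" using t_pos_imp_pr_pos[OF dual feas rs(1,2), of k] that by auto
    then show ?thesis using F(1)[of k] F(2)[of k] that by simp
  qed
  have sum_pr: "sum pr ?A = sum pr {1..S}" by (intro sum.mono_neutral_left) (use zero in auto)
  have sum_t: "sum t ?A = 1" unfolding F(5)[symmetric]
    by (intro sum.mono_neutral_left) (use zero in auto)
  have sum_pd: "sum pd ?B = sum pd {1..L}"
    by (intro sum.mono_neutral_left) (use F(3) in \<open>auto simp: less_le\<close>)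
  \<comment> \<open>Summing the proportionality over the active paths identifies its constant as the
    reciprocal of the total cascaded power.\<close>
  have "1 = (\<Sum>k\<in>?A. 2 * v / w * pr k)"
    unfolding sum_t[symmetric] by (intro sum.cong) (use active_t_eq[OF dual feas] in auto)
  also have "\<dots> = 2 * v / w * sum pr {1..S}" by (simp only: sum_pr flip: sum_distrib_left)
  finally have total: "2 * v / w = 1 / sum pr {1..S}"
    by (metis mult_zero_right nonzero_eq_divide_eq zero_neq_one)
  have active: "0 < pr k \<and> 0 < t k \<and> 0 \<le> 1 / w\<^sup>2 - 1 / (mr k * pr k) \<and> pr k = 1 / v - 1 / (mr k * (t k)\<^sup>2) \<and>
      t k = 1 / w + sqrt (1 / w\<^sup>2 - 1 / (mr k * pr k)) \<and>
      t k = 2 * v / w * pr k \<and> t k = 1 / sum pr {1..S} * pr k" if k: "k \<in> ?A" for k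
  proof -
    have k': "k \<in> {1..S}" "0 < pr k" using k by auto
    note K = active_path_dual_eqs[OF dual feas k']
    \<comment> \<open>Whichever of \<open>r\<close> and \<open>s\<close> differs from
      \<open>k\<close> is the partner required by the bound on the signal-to-noise ratio.\<close>
    obtain l where l: "l \<in> {1..S}" "0 < pr l" "l \<noteq> k" using rs by metis
    have snr: "1 \<le> mr k * pr k * (t k)\<^sup>2"
      using active_snr_gt_2[OF opt k' l] by simp
    have gain: "0 < mr k * (t k)\<^sup>2" using mr[OF k'(1)] K(1) by simp
    have "mr k * (t k)\<^sup>2 / (1 + mr k * (t k)\<^sup>2 * pr k) = v"
      using K(4) by (simp add: mult_ac)
    then have "pr k = 1 / v - 1 / (mr k * (t k)\<^sup>2)"
      using k'(2) by (intro water_level_solution(3)[OF gain]) auto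
    then show ?thesis
      using k'(2) K(1) time_share_root[OF mr[OF k'(1)] k'(2) K(1) snr K(5)] active_t_eq[OF dual feas k']
      unfolding total by blast
  qed
  have direct: "pd i = 1 / v - 1 / md i" if "i \<in> ?B" for i
    by (rule water_level_solution(3)[OF md F(3)]) (use that D in auto)
  have total_power: "sum pr ?A + sum pd ?B = P" using sum_pr sum_pd F(4) by simp
  have vw: "0 < v" "0 < w" using active_path_dual_eqs[OF dual feas rs(1,2)] by auto
  show ?thesis
    unfolding multi_path_system_def using vw active direct sum_t total_power by blast
qed

lemma optimal_normalized_structure:
  assumes opt: "optimal pr pd t" and norm: "normalized S mr pr t"
  shows "\<exists>(Sa, Ia)\<in>activation_sets S L. inactive_zero S L Sa Ia pr pd t \<and>
           (if Sa = {1} then single_path_water_filling S L P mr md pr pd t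
            else (\<exists>v w. dual_variables pr pd t v w) \<and>
                 (\<forall>v w. dual_variables pr pd t v w \<longrightarrow>
                    multi_path_system S P mr md Sa Ia v w pr pd t))"
proof -
  have feas: "feasible pr pd t" using opt by (auto simp: P3_optimal_def)
  note F = feasibleD[OF feas]
  obtain v w where dual: "dual_variables pr pd t v w" using optimal_dual_variables[OF opt] .
  define A where "A = {s \<in> {1..S}. 0 < pr s}"
  define B where "B = {i \<in> {1..L}. 0 < pd i}"
  have inactive: "pr s = 0 \<and> t s = 0" if s: "s \<in> {1..S} - A" "A \<noteq> {}" for s
  proof -
    obtain r where "r \<in> A" using s(2) by blast
    then have r: "r \<in> {1..S}" "0 < pr r" by (auto simp: A_def)
    have "\<not> 0 < t s" using t_pos_imp_pr_pos[OF dual feas r, of s] s by (auto simp: A_def)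
    then show ?thesis using F(1)[of s] F(2)[of s] s by (simp add: A_def)
  qed
  have segA: "\<exists>k\<in>{1..S}. A = {1..k}" if "A \<noteq> {}"
    by (rule downward_closed_eq_atLeastAtMost[OF _ that])
      (use active_before_active[OF opt norm] in \<open>auto simp: A_def\<close>)
  have segB: "\<exists>l\<in>{1..L}. B = {1..l}" if "B \<noteq> {}"
    by (rule downward_closed_eq_atLeastAtMost[OF _ that])
      (use direct_before_active[OF dual feas] in \<open>auto simp: B_def\<close>)
  show ?thesis
  proof (cases "A \<subseteq> {1}")
    \<comment> \<open>This includes \<open>A = {}\<close>, where \<open>normalized\<close> puts all
      time on path 1 and water-filling gives it no power.\<close>
    case True
    have zero: "pr s = 0 \<and> t s = 0" if s: "s \<in> {2..S}" for s
    proof (cases "A = {}")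
      case True
      then have "\<forall>s\<in>{1..S}. pr s = 0" using F(1) by (force simp: A_def)
      then show ?thesis using norm s by (auto simp: normalized_def)
    next
      case False
      then show ?thesis using inactive[of s] s \<open>A \<subseteq> {1}\<close> by force
    qed
    \<comment> \<open>All direct paths may be listed here, since the maximum in the water-filling
      formula already handles the idle ones.\<close>
    have "\<exists>k\<in>{1..S}. {1} = {1..k}" "\<exists>l\<in>{1..L}. {1..L} = {1..l}"
      using S L by (auto intro: bexI[of _ 1])
    then have "({1}, {1..L}) \<in> activation_sets S L" unfolding activation_sets_def by blast
    moreover have "inactive_zero S L {1} {1..L} pr pd t"
      using zero by (auto simp: inactive_zero_def)
    ultimately show ?thesis using single_path_solution[OF dual feas zero] by force
  next
    case False
    then obtain k where k: "k \<in> {1..S}" "A = {1..k}" using segA by blast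
    have rs: "1 \<in> A" "k \<in> A" "1 \<noteq> k" using k False by auto
    have "(A, B) \<in> activation_sets S L"
      using False k segB by (auto simp: activation_sets_def)
    moreover have "inactive_zero S L A B pr pd t"
      using inactive rs(1) F(3) by (force simp: inactive_zero_def B_def)
    moreover have "multi_path_system S P mr md A B v w pr pd t"
      if "dual_variables pr pd t v w" for v w
      using multi_path_solution[OF opt that, of 1 k] rs unfolding A_def B_def by simp
    ultimately show ?thesis using False dual by force
  qed
qed

section \<open>Normalizing an optimal solution\<close>

lemma optimal_permute:
  assumes opt: "optimal pr pd t" and \<sigma>: "\<sigma> permutes {1..S}" "\<And>s. s \<in> {1..S} \<Longrightarrow> mr (\<sigma> s) = mr s"
  shows "optimal (pr \<circ> \<sigma>) pd (t \<circ> \<sigma>)"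
proof -
  have feas: "feasible pr pd t" using opt by (auto simp: P3_optimal_def)
  note F = feasibleD[OF feas]
  have "sum (pr \<circ> \<sigma>) {1..S} = sum pr {1..S}" "sum (t \<circ> \<sigma>) {1..S} = sum t {1..S}"
    by (rule sum.permute[OF \<sigma>(1), symmetric])+
  then have "feasible (pr \<circ> \<sigma>) pd (t \<circ> \<sigma>)"
    unfolding P3_feasible_def using F permutes_in_image[OF \<sigma>(1)]
    by (simp del: atLeastAtMost_iff)
  moreover have "objective (pr \<circ> \<sigma>) pd (t \<circ> \<sigma>) = objective pr pd t"
    unfolding P3_objective_def
    by (subst (2) sum.permute[OF \<sigma>(1)]) (use \<sigma>(2) in \<open>auto intro!: sum.cong\<close>)
  ultimately show ?thesis using opt by (simp add: P3_optimal_def)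
qed

lemma optimal_normalize:
  assumes opt: "optimal pr pd t"
  shows "\<exists>\<sigma> t'. \<sigma> permutes {1..S} \<and> (\<forall>s\<in>{1..S}. mr (\<sigma> s) = mr s) \<and>
           ((\<exists>s\<in>{1..S}. pr s \<noteq> 0) \<longrightarrow> t' = t \<circ> \<sigma>) \<and>
           optimal (pr \<circ> \<sigma>) pd t' \<and> normalized S mr (pr \<circ> \<sigma>) t'"
proof (cases "\<exists>s\<in>{1..S}. pr s \<noteq> 0")
  case True
  obtain \<sigma> where \<sigma>: "\<sigma> permutes {1..S}" "\<And>s. s \<in> {1..S} \<Longrightarrow> mr (\<sigma> s) = mr s"
    and first: "\<And>r s. r \<in> {1..S} \<Longrightarrow> s \<in> {1..S} \<Longrightarrow> r < s \<Longrightarrow> mr r = mr s \<Longrightarrow>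
      pr (\<sigma> s) \<noteq> 0 \<Longrightarrow> pr (\<sigma> r) \<noteq> 0"
    by (rule permutation_moving_support_first[of S mr pr]) blast
  obtain s where s: "s \<in> {1..S}" "pr s \<noteq> 0" using True by blast
  have "inv \<sigma> s \<in> {1..S}" "\<sigma> (inv \<sigma> s) = s"
    using s(1) permutes_in_image[OF permutes_inv[OF \<sigma>(1)]] permutes_inverses(1)[OF \<sigma>(1)] by auto
  then have "\<exists>s\<in>{1..S}. (pr \<circ> \<sigma>) s \<noteq> 0" using s(2) by (metis comp_apply)
  then have "normalized S mr (pr \<circ> \<sigma>) (t \<circ> \<sigma>)"
    unfolding normalized_def using first by auto
  then show ?thesis using \<sigma> optimal_permute[OF opt \<sigma>] by blast
next
  case False
  \<comment> \<open>Without cascaded power the objective ignores \<open>t\<close>, so all time can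
    be moved to path 1.\<close>
  define t' :: "nat \<Rightarrow> real" where "t' s = (if s = 1 then 1 else 0)" for s
  have feas: "feasible pr pd t" using opt by (auto simp: P3_optimal_def)
  then have "feasible pr pd t'" using S by (auto simp: P3_feasible_def t'_def)
  moreover have "objective pr pd t' = objective pr pd t"
    using False by (simp add: P3_objective_def)
  ultimately have "optimal pr pd t'" using opt by (simp add: P3_optimal_def)
  moreover have "normalized S mr pr t'" using False by (auto simp: normalized_def t'_def)
  ultimately show ?thesis using False by (intro exI[of _ id] exI[of _ t']) (simp add: permutes_id)
qed

section \<open>Existence of an optimum and the candidates\<close>

text \<open>Points are functions on all naturals, so feasibility alone does not bound them. A box in
  the infinite product is compact by Tychonoff, its feasible part \<open>C\<close> contains a
  maximizer, and every feasible point has a representative of equal value in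
  \<open>C\<close>.\<close>

lemma optimal_exists: "\<exists>pr pd t. optimal pr pd t"
proof -
  \<comment> \<open>One box serves all three components: powers are at most \<open>P\<close> and
    time shares at most 1.\<close>
  define K :: "(nat \<Rightarrow> real) set" where "K = (\<Pi>\<^sub>E k\<in>UNIV. {0..max P 1})"
  have "compactin (product_topology (\<lambda>_. euclidean) UNIV) K"
    unfolding K_def by (subst compactin_PiE) simp
  then have K: "compact K" by (simp add: euclidean_product_topology)
  have coord: "continuous_on T (\<lambda>x. fst x k)" "continuous_on T (\<lambda>x. fst (snd x) k)"
    "continuous_on T (\<lambda>x. snd (snd x) k)"
    for T :: "((nat \<Rightarrow> real) \<times> (nat \<Rightarrow> real) \<times> (nat \<Rightarrow> real)) set" and k
    by (rule continuous_on_product_then_coordinatewise, intro continuous_intros)+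
  define C where "C = (K \<times> K \<times> K) \<inter>
    {x. (\<Sum>s = 1..S. fst x s) + (\<Sum>i = 1..L. fst (snd x) i) = P} \<inter>
    {x. (\<Sum>s = 1..S. snd (snd x) s) = 1}"
  have compact: "compact C" unfolding C_def
    by (intro compact_Int_closed compact_Times K closed_Collect_eq
        continuous_on_add continuous_on_sum continuous_on_const coord)
  have "((\<lambda>s. if s = 1 then P else 0), (\<lambda>_. 0), (\<lambda>s. if s = 1 then 1 else 0)) \<in> C"
    using S P by (auto simp: C_def K_def PiE_def)
  then have nonempty: "C \<noteq> {}" by blast
  have feas: "feasible pr pd t" if "(pr, pd, t) \<in> C" for pr pd t
    using that by (auto simp: C_def K_def P3_feasible_def PiE_def Pi_def)
  have cont: "continuous_on C (\<lambda>x. objective (fst x) (fst (snd x)) (snd (snd x)))"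
  proof -
    have pos: "1 + mr s * fst x s * (snd (snd x) s)\<^sup>2 \<noteq> 0" if "x \<in> C" "s \<in> {1..S}" for x s
      using snr_nonneg[OF feas[of "fst x" "fst (snd x)" "snd (snd x)"], of s] that by auto
    have pos': "1 + md i * fst (snd x) i \<noteq> 0" if "x \<in> C" "i \<in> {1..L}" for x i
      using feasibleD(3)[OF feas[of "fst x" "fst (snd x)" "snd (snd x)"], of i] md[of i] that
      by (auto simp: less_imp_le add_nonneg_eq_0_iff)
    show ?thesis unfolding P3_objective_def
      by (intro continuous_on_add continuous_on_sum continuous_on_ln continuous_on_mult
          continuous_on_power continuous_on_const coord ballI pos pos')
  qed
  obtain x where x: "x \<in> C" "\<And>y. y \<in> C \<Longrightarrow>
      objective (fst y) (fst (snd y)) (snd (snd y)) \<le> objective (fst x) (fst (snd x)) (snd (snd x))"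
    using continuous_attains_sup[OF compact nonempty cont] by blast
  have "objective pr pd t \<le> objective (fst x) (fst (snd x)) (snd (snd x))"
    if f: "feasible pr pd t" for pr pd t
  proof -
    note F = feasibleD[OF f]
    \<comment> \<open>Zeroing the values outside the index range changes neither constraints nor
      objective and brings the point into the box.\<close>
    define cut :: "nat \<Rightarrow> (nat \<Rightarrow> real) \<Rightarrow> nat \<Rightarrow> real"
      where "cut n g k = (if k \<in> {1..n} then g k else 0)" for n g k
    have cut: "cut n g k = g k" if "k \<in> {1..n}" for n g k using that by (simp add: cut_def)
    have "sum pr {1..S} \<ge> 0" "sum pd {1..L} \<ge> 0" using F by (auto intro: sum_nonneg)
    then have le: "sum pr {1..S} \<le> P" "sum pd {1..L} \<le> P" using F(4) by auto
    have "pr k \<le> P" if "k \<in> {1..S}" for k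
      using member_le_sum[of k "{1..S}" pr] F(1) that le by force
    moreover have "pd k \<le> P" if "k \<in> {1..L}" for k
      using member_le_sum[of k "{1..L}" pd] F(3) that le by force
    moreover have "t k \<le> 1" if "k \<in> {1..S}" for k
      using member_le_sum[of k "{1..S}" t] F(2) that F(5) by force
    ultimately have "(cut S pr, cut L pd, cut S t) \<in> C"
      using F P by (auto simp: C_def K_def cut_def PiE_def le_max_iff_disj)
    moreover have "objective (cut S pr) (cut L pd) (cut S t) = objective pr pd t"
      unfolding P3_objective_def
      by (intro arg_cong2[where f="(+)"] sum.cong refl) (simp_all only: cut)
    ultimately show ?thesis using x(2)[of "(cut S pr, cut L pd, cut S t)"] by simp
  qed
  then have "optimal (fst x) (fst (snd x)) (snd (snd x))"
    using feas[of "fst x" "fst (snd x)" "snd (snd x)"] x(1) by (simp add: P3_optimal_def)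
  then show ?thesis by blast
qed

text \<open>One optimum that is a candidate is enough: it is a best candidate, and every best
  candidate must attain its value.\<close>

lemma optimal_candidate_exists:
  obtains pr pd t where "optimal pr pd t" "P3_candidate S L P mr md pr pd t"
proof -
  obtain pr pd t where opt: "optimal pr pd t" and norm: "normalized S mr pr t"
    using optimal_exists optimal_normalize by blast
  obtain Sa Ia where SI: "(Sa, Ia) \<in> activation_sets S L" "inactive_zero S L Sa Ia pr pd t"
    and sol: "if Sa = {1} then single_path_water_filling S L P mr md pr pd t
            else (\<exists>v w. dual_variables pr pd t v w) \<and>
                 (\<forall>v w. dual_variables pr pd t v w \<longrightarrow>
                    multi_path_system S P mr md Sa Ia v w pr pd t)"
    using optimal_normalized_structure[OF opt norm] by blast
  have "if Sa = {1} then single_path_water_filling S L P mr md pr pd t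
        else (\<exists>v w. multi_path_system S P mr md Sa Ia v w pr pd t)"
    using sol by (auto split: if_splits)
  then have "P3_candidate S L P mr md pr pd t"
    using SI opt unfolding P3_candidate_def P3_optimal_def by blast
  then show ?thesis using opt that by blast
qed

end

theorem mainTheorem2:
  fixes S L3 :: nat and P :: real and mr md :: "nat \<Rightarrow> real"
  assumes "1 \<le> S" and "1 \<le> L3" and "0 < P"
    and "\<forall>s\<in>{1..S}. 0 < mr s" and "antimono_on {1..S} mr"
    and "\<forall>i\<in>{1..L3}. 0 < md i" and "antimono_on {1..L3} md"
  shows
    "(\<forall>pr pd t. P3_optimal S L3 P mr md pr pd t \<and> normalized S mr pr t \<longrightarrow>
        (\<exists>(Sa, Ia)\<in>activation_sets S L3. inactive_zero S L3 Sa Ia pr pd t \<and>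
           (if Sa = {1} then single_path_water_filling S L3 P mr md pr pd t
            else (\<exists>v w. P3_dual_variables S L3 P mr md pr pd t v w) \<and>
                 (\<forall>v w. P3_dual_variables S L3 P mr md pr pd t v w \<longrightarrow>
                    multi_path_system S P mr md Sa Ia v w pr pd t)))) \<and>
     (\<forall>pr pd t. P3_optimal S L3 P mr md pr pd t \<longrightarrow>
        (\<exists>\<sigma> t'. \<sigma> permutes {1..S} \<and> (\<forall>s\<in>{1..S}. mr (\<sigma> s) = mr s) \<and>
           ((\<exists>s\<in>{1..S}. pr s \<noteq> 0) \<longrightarrow> t' = t \<circ> \<sigma>) \<and>
           P3_optimal S L3 P mr md (pr \<circ> \<sigma>) pd t' \<and> normalized S mr (pr \<circ> \<sigma>) t')) \<and>
     (\<exists>pr pd t. P3_best_candidate S L3 P mr md pr pd t) \<and>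
     (\<forall>pr pd t. P3_best_candidate S L3 P mr md pr pd t \<longrightarrow>
        P3_optimal S L3 P mr md pr pd t)"
proof -
  interpret cascaded_channel S L3 P mr md
    using assms by unfold_locales auto
  obtain pr0 pd0 t0 where opt0: "optimal pr0 pd0 t0" and cand0: "P3_candidate S L3 P mr md pr0 pd0 t0"
    using optimal_candidate_exists .
  have "P3_best_candidate S L3 P mr md pr0 pd0 t0"
    using opt0 cand0 by (auto simp: P3_best_candidate_def P3_optimal_def P3_candidate_def)
  moreover have "optimal pr pd t" if "P3_best_candidate S L3 P mr md pr pd t" for pr pd t
    using that opt0 cand0 unfolding P3_best_candidate_def P3_optimal_def P3_candidate_def
    by (meson order_trans)
  ultimately show ?thesis
    by (intro conjI allI impI optimal_normalized_structure optimal_normalize) blast+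
qed

end
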